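(* Let $R$ be a unital ring with involution and let $a\in R$. The following assertions are equivalent: (i) $a$ is group invertible. (ii) There exists an idempotent $q\in R$ such that $qR=aR$ and $Rq=Ra$. (iii) $a$ is (von Neumann) regular and there exists an idempotent $q\in R$ such that ${}^\circ a={}^\circ q$ and $a^\circ=q^\circ$. If these assertions hold, then the idempotent $q$ in (ii) is unique, the idempotent $q$ in (iii) is unique, and the two coincide. Moreover, in this case the element $qa^{(1)}q$ does not depend on the choice of $a^{(1)}\in a\{1\}$, and $$a=\begin{bmatrix} a & 0 \\ 0 & 0 \end{bmatrix}_{q\times q},\qquad a^\#=\begin{bmatrix} qa^{(1)}q & 0 \\ 0 & 0 \end{bmatrix}_{q\times q}.$$
   Context: For $a\in R$: $aR=\{ax:x\in R\}$, $Ra=\{xa:x\in R\}$, $a^\circ=\{x\in R: ax=0\}$, ${}^\circ a=\{x\in R: xa=0\}$. The element $a$ is regular if there is $x\in R$ with $axa=a$; $a\{1\}$ is the set of all such $x$ (inner inverses), and $a^{(1)}$ denotes an arbitrary element of $a\{1\}$. The element $a$ is group invertible if there is $x\in R$ with $axa=a$, $xax=x$, $ax=xa$; such $x$ is unique and is denoted $a^\#$. For idempotents $s,t\in R$, the notation $x=\begin{bmatrix} x_{11} & x_{12} \\ x_{21} & x_{22} \end{bmatrix}_{s\times t}$ means $x_{11}=sxt$, $x_{12}=sx(1-t)$, $x_{21}=(1-s)xt$, $x_{22}=(1-s)x(1-t)$ (so $x$ is the sum of the four entries). *)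

theory Defs
  imports Main
begin

text \<open>Unital rings with involution. The class is built from \<^class>\<open>ring\<close> and \<^class>\<open>monoid_mult\<close>
  rather than from \<^class>\<open>ring_1\<close>, because the latter excludes the zero ring.\<close>

class involution_ring = ring + monoid_mult +
  fixes star :: "'a \<Rightarrow> 'a"
  assumes star_star: "star (star x) = x"
    and star_add: "star (x + y) = star x + star y"
    and star_mult: "star (x * y) = star y * star x"

definition right_ideal :: "'a::involution_ring \<Rightarrow> 'a set" where
  "right_ideal a = {a * x | x. True}"

definition left_ideal :: "'a::involution_ring \<Rightarrow> 'a set" where
  "left_ideal a = {x * a | x. True}"

text \<open>\<open>right_ann a\<close> is $a^\circ$ and \<open>left_ann a\<close> is ${}^\circ a$.\<close>

definition right_ann :: "'a::involution_ring \<Rightarrow> 'a set" where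
  "right_ann a = {x. a * x = 0}"

definition left_ann :: "'a::involution_ring \<Rightarrow> 'a set" where
  "left_ann a = {x. x * a = 0}"

definition inner_inverses :: "'a::involution_ring \<Rightarrow> 'a set" where
  "inner_inverses a = {x. a * x * a = a}"

definition vn_regular :: "'a::involution_ring \<Rightarrow> bool" where
  "vn_regular a \<longleftrightarrow> (\<exists>x. a * x * a = a)"

definition idempotent :: "'a::involution_ring \<Rightarrow> bool" where
  "idempotent q \<longleftrightarrow> q * q = q"

definition is_group_inverse :: "'a::involution_ring \<Rightarrow> 'a \<Rightarrow> bool" where
  "is_group_inverse a x \<longleftrightarrow> a * x * a = a \<and> x * a * x = x \<and> a * x = x * a"

definition group_invertible :: "'a::involution_ring \<Rightarrow> bool" where
  "group_invertible a \<longleftrightarrow> (\<exists>x. is_group_inverse a x)"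

text \<open>Meaningful only if \<open>a\<close> is group invertible; see \<open>is_group_inverse_group_inverse\<close> below.\<close>

definition group_inverse :: "'a::involution_ring \<Rightarrow> 'a" where
  "group_inverse a = (THE x. is_group_inverse a x)"

lemma is_group_inverse_unique:
  assumes x: "is_group_inverse a x" and y: "is_group_inverse a y"
  shows "x = y"
proof -
  have "a * x = (a * y * a) * x" using y by (metis is_group_inverse_def)
  also have "\<dots> = y * a * (x * a)"
    using x y by (metis is_group_inverse_def mult.assoc)
  also have "\<dots> = y * a" using x by (metis is_group_inverse_def mult.assoc)
  finally have ax: "a * x = y * a" .
  have "x = x * (a * x)" using x by (metis is_group_inverse_def mult.assoc)
  also have "\<dots> = x * a * y" using ax y by (metis is_group_inverse_def mult.assoc)
  also have "\<dots> = y * a * y" using ax x by (metis is_group_inverse_def)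
  also have "\<dots> = y" using y by (simp add: is_group_inverse_def)
  finally show ?thesis .
qed

lemma is_group_inverse_group_inverse:
  "group_invertible a \<Longrightarrow> is_group_inverse a (group_inverse a)"
  unfolding group_invertible_def group_inverse_def
  by (metis is_group_inverse_unique theI)

text \<open>\<open>block_form s t x x11 x12 x21 x22\<close> says that \<open>x\<close> is represented by the matrix with rows
  \<open>(x11, x12)\<close> and \<open>(x21, x22)\<close> relative to \<open>s \<times> t\<close>; used for idempotents \<open>s\<close> and \<open>t\<close>.\<close>

definition block_form ::
  "'a::involution_ring \<Rightarrow> 'a \<Rightarrow> 'a \<Rightarrow> 'a \<Rightarrow> 'a \<Rightarrow> 'a \<Rightarrow> 'a \<Rightarrow> bool" where
  "block_form s t x x11 x12 x21 x22 \<longleftrightarrow>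
     x11 = s * x * t \<and> x12 = s * x * (1 - t) \<and>
     x21 = (1 - s) * x * t \<and> x22 = (1 - s) * x * (1 - t)"

lemma block_form_sum:
  "block_form s t x x11 x12 x21 x22 \<Longrightarrow> x = x11 + x12 + x21 + x22"
  unfolding block_form_def
  by (elim conjE, hypsubst) (simp add: algebra_simps)

end

(* If qR = aR and Rq = Ra with q idempotent, then q = a u = v a for some u, v and q a = a = a q.
   Hence for every inner inverse x of a, both a (q x q) = a x a u and (q x q) a = v a x a
   equal q, so q x q is the group inverse of a. Conversely a times its group inverse is such a q.
   For regular a, taking annihilators is faithful on the principal ideals involved, because
   1 - a x generates the left annihilator of a and 1 - x a generates its right annihilator. *)

theory Submission
  imports Defs
begin

text \<open>Since the ring has a unit, each generator lies in its own ideal, so equality makes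
  \<open>a\<close> and \<open>q\<close> right multiples of each other. From
  \<open>a = q * y\<close>, idempotency gives \<open>q * a = a\<close>. All later work with ideals
  goes through these equations.\<close>

lemma right_ideal_eq_iff:
  assumes "idempotent q"
  shows "right_ideal q = right_ideal a \<longleftrightarrow> q * a = a \<and> (\<exists>u. q = a * u)"
proof
  assume eq: "right_ideal q = right_ideal a"
  have "a * 1 \<in> right_ideal a" "q * 1 \<in> right_ideal q"
    unfolding right_ideal_def by blast+
  then have "a \<in> right_ideal q" "q \<in> right_ideal a"
    using eq by simp_all
  then obtain y u where "a = q * y" "q = a * u"
    unfolding right_ideal_def by blast
  with assms show "q * a = a \<and> (\<exists>u. q = a * u)"
    by (metis idempotent_def mult.assoc)
next
  assume "q * a = a \<and> (\<exists>u. q = a * u)"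
  then obtain u where "q * a = a" "q = a * u" by blast
  then have "q * y = a * (u * y)" "a * y = q * (a * y)" for y
    by (metis mult.assoc)+
  then show "right_ideal q = right_ideal a"
    unfolding right_ideal_def by blast
qed

lemma left_ideal_eq_iff:
  assumes "idempotent q"
  shows "left_ideal q = left_ideal a \<longleftrightarrow> a * q = a \<and> (\<exists>v. q = v * a)"
proof
  assume eq: "left_ideal q = left_ideal a"
  have "1 * a \<in> left_ideal a" "1 * q \<in> left_ideal q"
    unfolding left_ideal_def by blast+
  then have "a \<in> left_ideal q" "q \<in> left_ideal a"
    using eq by simp_all
  then obtain y v where "a = y * q" "q = v * a"
    unfolding left_ideal_def by blast
  with assms show "a * q = a \<and> (\<exists>v. q = v * a)"
    by (metis idempotent_def mult.assoc)
next
  assume "a * q = a \<and> (\<exists>v. q = v * a)"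
  then obtain v where "a * q = a" "q = v * a" by blast
  then have "y * q = (y * v) * a" "y * a = (y * a) * q" for y
    by (metis mult.assoc)+
  then show "left_ideal q = left_ideal a"
    unfolding left_ideal_def by blast
qed

text \<open>The bridge between (ii) and (iii). Equal annihilators let \<open>1 - q\<close>, which
  kills \<open>q\<close>, also kill \<open>a\<close>, and let \<open>1 - a * x\<close>, which kills
  \<open>a\<close>, also kill \<open>q\<close>. These two equations are exactly those of
  \<open>right_ideal_eq_iff\<close>, with \<open>x * q\<close> as the factor.\<close>

lemma left_ann_eq_iff_right_ideal_eq:
  assumes q: "idempotent q" and x: "a * x * a = a"
  shows "left_ann a = left_ann q \<longleftrightarrow> right_ideal q = right_ideal a"
proof
  assume eq: "left_ann a = left_ann q"
  have "1 - q \<in> left_ann q" "1 - a * x \<in> left_ann a"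
    using q x by (simp_all add: left_ann_def idempotent_def left_diff_distrib)
  then have "(1 - q) * a = 0" "(1 - a * x) * q = 0"
    using eq unfolding left_ann_def by auto
  then have "q * a = a" "q = a * (x * q)"
    by (simp_all add: left_diff_distrib mult.assoc)
  then show "right_ideal q = right_ideal a"
    using q right_ideal_eq_iff by blast
next
  assume "right_ideal q = right_ideal a"
  then obtain u where "q * a = a" "q = a * u"
    using q right_ideal_eq_iff by blast
  \<comment> \<open>Each of \<open>a\<close> and \<open>q\<close> is a right multiple of the other,
    so whatever kills one from the left kills the other.\<close>
  then have "y * a = 0 \<longleftrightarrow> y * q = 0" for y
    by (metis mult.assoc mult_zero_left)
  then show "left_ann a = left_ann q"
    unfolding left_ann_def by blast
qed

text \<open>The mirror image, with \<open>1 - x * a\<close> in place of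
  \<open>1 - a * x\<close>.\<close>

lemma right_ann_eq_iff_left_ideal_eq:
  assumes q: "idempotent q" and x: "a * x * a = a"
  shows "right_ann a = right_ann q \<longleftrightarrow> left_ideal q = left_ideal a"
proof
  assume eq: "right_ann a = right_ann q"
  have "1 - q \<in> right_ann q" "1 - x * a \<in> right_ann a"
    using q x by (simp_all add: right_ann_def idempotent_def right_diff_distrib mult.assoc)
  then have "a * (1 - q) = 0" "q * (1 - x * a) = 0"
    using eq unfolding right_ann_def by auto
  then have "a * q = a" "q = (q * x) * a"
    by (simp_all add: right_diff_distrib mult.assoc)
  then show "left_ideal q = left_ideal a"
    using q left_ideal_eq_iff by blast
next
  assume "left_ideal q = left_ideal a"
  then obtain v where "a * q = a" "q = v * a"
    using q left_ideal_eq_iff by blast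
  then have "a * y = 0 \<longleftrightarrow> q * y = 0" for y
    by (metis mult.assoc mult_zero_right)
  then show "right_ann a = right_ann q"
    unfolding right_ann_def by blast
qed

text \<open>Equal right ideals give \<open>q * p = p\<close>, and equal left ideals give
  \<open>q * p = q\<close>.\<close>

lemma idempotent_ideals_unique:
  assumes "idempotent p" "idempotent q"
    and "right_ideal p = right_ideal q" "left_ideal p = left_ideal q"
  shows "p = q"
  using assms right_ideal_eq_iff left_ideal_eq_iff by metis

text \<open>If \<open>q = a * u\<close> and \<open>q * a = a\<close>, then \<open>u\<close> is an
  inner inverse of \<open>a\<close>.\<close>

lemma ideals_imp_regular:
  assumes "idempotent q" "right_ideal q = right_ideal a"
  shows "vn_regular a"
  using assms right_ideal_eq_iff unfolding vn_regular_def by metis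

lemma is_group_inverse_corner:
  assumes q: "idempotent q" "right_ideal q = right_ideal a" "left_ideal q = left_ideal a"
    and x: "a * x * a = a"
  shows "is_group_inverse a (q * x * q)"
proof -
  obtain u where u: "q * a = a" "q = a * u"
    using q right_ideal_eq_iff by blast
  obtain v where v: "a * q = a" "q = v * a"
    using q left_ideal_eq_iff by blast
  \<comment> \<open>The last \<open>q\<close> is written as \<open>a * u\<close>, which exposes
    \<open>a * x * a\<close>. Dually, the product in the other order writes the first
    \<open>q\<close> as \<open>v * a\<close>.\<close>
  have "a * (q * x * q) = (a * q) * x * a * u"
    using u(2) by (simp add: mult.assoc)
  also have "\<dots> = q" using u(2) v(1) x by simp
  finally have aq: "a * (q * x * q) = q" .
  have "q * x * q * a = v * (a * x * (q * a))"
    by (subst v(2)) (simp add: mult.assoc)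
  also have "\<dots> = q" using u(1) v(2) x by simp
  finally have qa: "q * x * q * a = q" .
  \<comment> \<open>With \<open>z = q * x * q\<close>, both \<open>a * z\<close> and
    \<open>z * a\<close> equal \<open>q\<close>. The two other equations reduce to
    \<open>q * a = a\<close> and \<open>q * z = z\<close>.\<close>
  show ?thesis
    using aq qa u(1) q(1) unfolding is_group_inverse_def idempotent_def
    by (metis mult.assoc)
qed

text \<open>By uniqueness of the group inverse. The left side does not mention \<open>x\<close>, so
  this also shows that \<open>q * x * q\<close> is independent of the inner inverse chosen.\<close>

lemma group_inverse_eq_corner:
  assumes "idempotent q" "right_ideal q = right_ideal a" "left_ideal q = left_ideal a"
    and "x \<in> inner_inverses a"
  shows "group_inverse a = q * x * q"
  using assms is_group_inverse_corner is_group_inverse_unique is_group_inverse_group_inverse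
  unfolding inner_inverses_def group_invertible_def by blast

lemma group_invertible_iff_ideals:
  "group_invertible a \<longleftrightarrow>
    (\<exists>q. idempotent q \<and> right_ideal q = right_ideal a \<and> left_ideal q = left_ideal a)"
proof
  assume "group_invertible a"
  then obtain x where x: "a * x * a = a" "a * x = x * a"
    unfolding group_invertible_def is_group_inverse_def by blast
  have q: "idempotent (a * x)"
    unfolding idempotent_def by (metis x(1) mult.assoc)
  moreover have "right_ideal (a * x) = right_ideal a"
    using q x right_ideal_eq_iff by blast
  \<comment> \<open>Commutation enters here: \<open>a * x = x * a\<close> is a left multiple of
    \<open>a\<close>, and \<open>a * (a * x) = a * x * a = a\<close>.\<close>
  moreover have "left_ideal (a * x) = left_ideal a"
    using q x left_ideal_eq_iff mult.assoc by metis
  ultimately show "\<exists>q. idempotent q \<and> right_ideal q = right_ideal a \<and> left_ideal q = left_ideal a"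
    by blast
next
  assume "\<exists>q. idempotent q \<and> right_ideal q = right_ideal a \<and> left_ideal q = left_ideal a"
  then show "group_invertible a"
    using ideals_imp_regular is_group_inverse_corner
    unfolding vn_regular_def group_invertible_def by blast
qed

lemma block_form_corner:
  assumes "idempotent q" "q * x = x" "x * q = x"
  shows "block_form q q x x 0 0 0"
  using assms by (simp add: block_form_def left_diff_distrib right_diff_distrib)

theorem theorem2p11:
  fixes a :: "'a::involution_ring"
  shows
    "(group_invertible a \<longleftrightarrow>
        (\<exists>q. idempotent q \<and> right_ideal q = right_ideal a \<and> left_ideal q = left_ideal a)) \<and>
     (group_invertible a \<longleftrightarrow>
        vn_regular a \<and>
        (\<exists>q. idempotent q \<and> left_ann a = left_ann q \<and> right_ann a = right_ann q)) \<and>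
     (group_invertible a \<longrightarrow>
        (\<exists>!q. idempotent q \<and> right_ideal q = right_ideal a \<and> left_ideal q = left_ideal a) \<and>
        (\<exists>!q. idempotent q \<and> left_ann a = left_ann q \<and> right_ann a = right_ann q) \<and>
        (\<forall>p q. idempotent p \<and> right_ideal p = right_ideal a \<and> left_ideal p = left_ideal a \<longrightarrow>
               idempotent q \<and> left_ann a = left_ann q \<and> right_ann a = right_ann q \<longrightarrow>
               p = q) \<and>
        (\<forall>q. idempotent q \<and> right_ideal q = right_ideal a \<and> left_ideal q = left_ideal a \<longrightarrow>
             (\<forall>x\<in>inner_inverses a. \<forall>y\<in>inner_inverses a. q * x * q = q * y * q) \<and>
             block_form q q a a 0 0 0 \<and>
             (\<forall>x\<in>inner_inverses a.
                block_form q q (group_inverse a) (q * x * q) 0 0 0)))"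
proof -
  let ?I = "\<lambda>q. idempotent q \<and> right_ideal q = right_ideal a \<and> left_ideal q = left_ideal a"
  let ?A = "\<lambda>q. idempotent q \<and> left_ann a = left_ann q \<and> right_ann a = right_ann q"
  \<comment> \<open>For regular \<open>a\<close>, (ii) and (iii) select the same idempotents, so
    uniqueness in (iii) and the coincidence of the two idempotents reduce to uniqueness in
    (ii).\<close>
  have A_iff: "?A q \<longleftrightarrow> ?I q" if "vn_regular a" for q
    using that left_ann_eq_iff_right_ideal_eq right_ann_eq_iff_left_ideal_eq
    unfolding vn_regular_def by blast
  have unique: "p = q" if "?I p" "?I q" for p q
    using that idempotent_ideals_unique by metis
  have iff: "group_invertible a \<longleftrightarrow> (\<exists>q. ?I q)"
    by (rule group_invertible_iff_ideals)
  have regular: "vn_regular a" if "group_invertible a"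
    using that iff ideals_imp_regular by blast
  have ann_iff: "group_invertible a \<longleftrightarrow> vn_regular a \<and> (\<exists>q. ?A q)"
    using iff regular A_iff by blast
  have ex1_I: "\<exists>!q. ?I q" if "group_invertible a"
    using that iff unique by blast
  have ex1_A: "\<exists>!q. ?A q" if "group_invertible a"
    using ex1_I[OF that] unfolding A_iff[OF regular[OF that]] .
  have coincide: "\<forall>p q. ?I p \<longrightarrow> ?A q \<longrightarrow> p = q" if "group_invertible a"
    unfolding A_iff[OF regular[OF that]] using unique by blast
  have corner: "\<forall>q. ?I q \<longrightarrow>
      (\<forall>x\<in>inner_inverses a. \<forall>y\<in>inner_inverses a. q * x * q = q * y * q) \<and>
      block_form q q a a 0 0 0 \<and>
      (\<forall>x\<in>inner_inverses a. block_form q q (group_inverse a) (q * x * q) 0 0 0)"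
  proof (rule allI, rule impI, intro conjI ballI)
    fix q x y
    assume q: "?I q"
    assume "x \<in> inner_inverses a" "y \<in> inner_inverses a"
    then show "q * x * q = q * y * q"
      using q group_inverse_eq_corner by metis
  next
    fix q
    assume q: "?I q"
    then show "block_form q q a a 0 0 0"
      using right_ideal_eq_iff left_ideal_eq_iff by (blast intro: block_form_corner)
  next
    fix q x
    assume q: "?I q"
    assume "x \<in> inner_inverses a"
    then have "group_inverse a = q * x * q"
      using q group_inverse_eq_corner by blast
    moreover have "q * (q * x * q) = q * x * q" "q * x * q * q = q * x * q"
      using q unfolding idempotent_def by (metis mult.assoc)+
    ultimately show "block_form q q (group_inverse a) (q * x * q) 0 0 0"
      using q by (simp add: block_form_corner)
  qed
  show ?thesis
    by (intro conjI impI iff ann_iff ex1_I ex1_A coincide corner)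
qed

end
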